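(* Let $n\ge1$. For every $\alpha\in[0,1]$ and every integer $m\ge0$, $\binom{m-\alpha}{m}\ge0$. Consequently the base measure $$h(x_1,\dots,x_n)=\binom{m-\alpha}{m}\binom{N}{x_1,\dots,x_n},\qquad N=\sum_ix_i,\quad m=\lfloor N/2\rfloor,$$ satisfies $h(x_1,\dots,x_n)\ge0$ for every $\alpha\in[0,1]$ and every $(x_1,\dots,x_n)\in\mathbb Z_{\ge0}^n$, so that $M_\alpha=e^{\Psi_\alpha}$ is the partition function (and $\Psi_\alpha$ the log-partition function) of an exponential family with non-negative base measure on $\mathbb Z_{\ge0}^n$ for every $\alpha\in[0,1]$. This family is regular (full-dimensional natural parameter, infinite support) for $0\le\alpha<1$, and at $\alpha=1$ it is a finite-support boundary family, with support $\{0,e_1,\dots,e_n\}$ (i.e. $N\in\{0,1\}$ only), where the natural parameter is still full-dimensional.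
   Context: Notation: $\binom{m-\alpha}{m}:=\frac{(1-\alpha)(2-\alpha)\cdots(m-\alpha)}{m!}$ for $m\ge1$, $\binom{-\alpha}{0}:=1$, $\binom{N}{x_1,\dots,x_n}=\frac{N!}{x_1!\cdots x_n!}$; $e_1,\dots,e_n$ are the standard basis vectors. $\Omega:=\{\theta\in\mathbb R^n:\sum_ie^{\theta^i}<1\}$ and, on $\Omega$, $\Psi_\alpha(\theta):=\alpha\log(1+s)-(1-\alpha)\log(1-s)$ with $s=\sum_ie^{\theta^i}$. The exponential family in question is $p_\theta(x)=h(x)e^{\theta\cdot x-\Psi_\alpha(\theta)}$ for $x\in\mathbb Z_{\ge0}^n$, with $e^{\Psi_\alpha(\theta)}=\sum_{x}h(x)e^{\theta\cdot x}$; its support is the set of $x$ with $h(x)>0$. *)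

theory Defs
  imports "HOL-Analysis.Analysis"
begin

(* The symbol written binom(m - alpha, m); the empty product gives the value 1 at m = 0. *)
definition shifted_binomial :: "real \<Rightarrow> nat \<Rightarrow> real" where
  "shifted_binomial \<alpha> m = (\<Prod>k = 1..m. real k - \<alpha>) / fact m"

lemma shifted_binomial_eq_gbinomial: "shifted_binomial \<alpha> m = (real m - \<alpha>) gchoose m"
proof -
  have "(\<Prod>k = 1..m. real k - \<alpha>) = (\<Prod>i = 0..<m. 1 - \<alpha> + real i)"
    by (rule prod.reindex_bij_witness[of _ "\<lambda>i. i + 1" "\<lambda>k. k - 1"]) (auto simp: of_nat_diff)
  then show ?thesis
    by (simp add: shifted_binomial_def gbinomial_pochhammer' pochhammer_prod)
qed

text \<open>Points of \<open>\<int>\<^sub>\<ge>\<^sub>0\<^sup>n\<close> are vectors of type \<^typ>\<open>nat ^ 'n\<close>, where \<open>n = CARD('n) \<ge> 1\<close>.\<close>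

definition coord_sum :: "nat ^ 'n \<Rightarrow> nat" where
  "coord_sum x = (\<Sum>i\<in>UNIV. x $ i)"

definition real_vec :: "nat ^ 'n \<Rightarrow> real ^ 'n" where
  "real_vec x = (\<chi> i. real (x $ i))"

definition multinomial :: "nat ^ 'n \<Rightarrow> real" where
  "multinomial x = fact (coord_sum x) / (\<Prod>i\<in>UNIV. fact (x $ i))"

definition base_measure :: "real \<Rightarrow> nat ^ 'n \<Rightarrow> real" where
  "base_measure \<alpha> x = shifted_binomial \<alpha> (coord_sum x div 2) * multinomial x"

definition exp_sum :: "real ^ 'n \<Rightarrow> real" where
  "exp_sum \<theta> = (\<Sum>i\<in>UNIV. exp (\<theta> $ i))"

definition Omega :: "(real ^ 'n) set" where
  "Omega = {\<theta>. exp_sum \<theta> < 1}"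

(* Intended for theta in Omega; elsewhere HOL's totalised ln gives an irrelevant value. *)
definition Psi :: "real \<Rightarrow> real ^ 'n \<Rightarrow> real" where
  "Psi \<alpha> \<theta> = \<alpha> * ln (1 + exp_sum \<theta>) - (1 - \<alpha>) * ln (1 - exp_sum \<theta>)"

definition M :: "real \<Rightarrow> real ^ 'n \<Rightarrow> real" where
  "M \<alpha> \<theta> = exp (Psi \<alpha> \<theta>)"

subsection \<open>Exponential families on the lattice of non-negative integer vectors\<close>

text \<open>A family is given by its parameter set \<open>\<Theta>\<close>, its base measure \<open>h\<close> (as a density with
  respect to counting measure) and its log-partition function \<open>\<psi>\<close>; the sufficient statistic
  is the identity.\<close>

definition is_partition_function ::
    "(real ^ 'n) set \<Rightarrow> (nat ^ 'n \<Rightarrow> real) \<Rightarrow> (real ^ 'n \<Rightarrow> real) \<Rightarrow> bool" where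
  "is_partition_function \<Theta> h Z \<longleftrightarrow>
     (\<forall>\<theta>\<in>\<Theta>. ((\<lambda>x. h x * exp (\<theta> \<bullet> real_vec x)) has_sum Z \<theta>) UNIV)"

definition family_density ::
    "(nat ^ 'n \<Rightarrow> real) \<Rightarrow> (real ^ 'n \<Rightarrow> real) \<Rightarrow> real ^ 'n \<Rightarrow> nat ^ 'n \<Rightarrow> real" where
  "family_density h \<psi> \<theta> x = h x * exp (\<theta> \<bullet> real_vec x - \<psi> \<theta>)"

definition exponential_family ::
    "(real ^ 'n) set \<Rightarrow> (nat ^ 'n \<Rightarrow> real) \<Rightarrow> (real ^ 'n \<Rightarrow> real) \<Rightarrow> bool" where
  "exponential_family \<Theta> h \<psi> \<longleftrightarrow>
     (\<forall>x. 0 \<le> h x) \<and>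
     is_partition_function \<Theta> h (\<lambda>\<theta>. exp (\<psi> \<theta>)) \<and>
     (\<forall>\<theta>\<in>\<Theta>. (\<forall>x. 0 \<le> family_density h \<psi> \<theta> x) \<and> (family_density h \<psi> \<theta> has_sum 1) UNIV)"

definition support :: "(nat ^ 'n \<Rightarrow> real) \<Rightarrow> (nat ^ 'n) set" where
  "support h = {x. 0 < h x}"

definition natural_parameter_space :: "(nat ^ 'n \<Rightarrow> real) \<Rightarrow> (real ^ 'n) set" where
  "natural_parameter_space h = {\<theta>. (\<lambda>x. h x * exp (\<theta> \<bullet> real_vec x)) summable_on UNIV}"

(* The usual "full rank" condition: the parameter set has non-empty interior, and the support
   lies in no proper affine subspace, so that no direction of the parameter is redundant. *)
definition full_dimensional :: "(real ^ 'n) set \<Rightarrow> (nat ^ 'n \<Rightarrow> real) \<Rightarrow> bool" where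
  "full_dimensional \<Theta> h \<longleftrightarrow>
     interior \<Theta> \<noteq> {} \<and> affine hull (real_vec ` support h) = UNIV"

(* The standard requirement (the parameter set is the whole natural parameter space, and is
   open) together with full dimension and infinite support. *)
definition regular_family :: "(real ^ 'n) set \<Rightarrow> (nat ^ 'n \<Rightarrow> real) \<Rightarrow> bool" where
  "regular_family \<Theta> h \<longleftrightarrow>
     \<Theta> = natural_parameter_space h \<and> open \<Theta> \<and> full_dimensional \<Theta> h \<and> infinite (support h)"

end

theory Submission
  imports Defs
begin

text \<open>With \<open>s = exp_sum \<theta>\<close> one has \<open>M\<^sub>\<alpha>(\<theta>) = (1 + s) (1 - s\<^sup>2)\<^bsup>\<alpha>-1\<^esup>\<close>. The binomial series
  expands this as \<open>\<Sum>\<^sub>N c\<^sub>N s\<^sup>N\<close>, where \<open>c\<^sub>N\<close> is the shifted binomial at \<open>\<lfloor>N/2\<rfloor>\<close>, and the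
  multinomial theorem spreads \<open>s\<^sup>N\<close> over the lattice points with coordinate sum \<open>N\<close>. For
  \<open>\<alpha> < 1\<close> the bound \<open>c\<^sub>N \<ge> (1 - \<alpha>) / N\<close> makes the series diverge as soon as \<open>s \<ge> 1\<close>, so
  \<open>Omega\<close> is the whole natural parameter space.\<close>

section \<open>Shifted binomial coefficients: sign, lower bound, generating function\<close>

lemma shifted_binomial_0 [simp]: "shifted_binomial \<alpha> 0 = 1"
  by (simp add: shifted_binomial_def)

lemma shifted_binomial_Suc:
  "shifted_binomial \<alpha> (Suc m) = shifted_binomial \<alpha> m * ((real (Suc m) - \<alpha>) / real (Suc m))"
  by (simp add: shifted_binomial_def)

lemma shifted_binomial_nonneg: "\<alpha> \<le> 1 \<Longrightarrow> 0 \<le> shifted_binomial \<alpha> m"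
  unfolding shifted_binomial_def by (intro divide_nonneg_nonneg prod_nonneg) auto

lemma shifted_binomial_pos: "\<alpha> < 1 \<Longrightarrow> 0 < shifted_binomial \<alpha> m"
  unfolding shifted_binomial_def by (intro divide_pos_pos prod_pos) auto

text \<open>The factor at \<open>k = 1\<close> vanishes, which is what cuts the boundary family down
  to finite support.\<close>

lemma shifted_binomial_1: "m > 0 \<Longrightarrow> shifted_binomial 1 m = 0"
  by (auto simp: shifted_binomial_def intro!: bexI[of _ 1])

text \<open>From \<open>m\<close> to \<open>m + 1\<close> the bound is multiplied by
  \<open>m / (m + 1)\<close>, the coefficient by \<open>(m + 1 - \<alpha>) / (m + 1)\<close>, which
  is no smaller because \<open>\<alpha> \<le> 1\<close>.\<close>

lemma shifted_binomial_lower_bound: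
  assumes "\<alpha> \<le> 1"
  shows "(1 - \<alpha>) / real m \<le> shifted_binomial \<alpha> m"
proof (induction m)
  case (Suc m)
  show ?case
  \<comment> \<open>Division by zero makes the bound 0 at \<open>m = 0\<close>, so the induction
    really starts at index 1, where both sides equal \<open>1 - \<alpha>\<close>.\<close>
  proof (cases "m = 0")
    case False
    have "(1 - \<alpha>) / real (Suc m) = (1 - \<alpha>) / real m * (real m / real (Suc m))"
      using False by simp
    also have "\<dots> \<le> shifted_binomial \<alpha> m * ((real (Suc m) - \<alpha>) / real (Suc m))"
      using assms Suc.IH by (intro mult_mono divide_right_mono shifted_binomial_nonneg) auto
    finally show ?thesis
      by (simp only: shifted_binomial_Suc)
  qed (simp add: shifted_binomial_Suc)
qed simp

text \<open>Newton's series at \<open>- u\<close> with exponent \<open>\<alpha> - 1\<close>: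
  negating the upper index absorbs the signs and turns \<open>\<alpha> - 1\<close> into
  \<open>m - \<alpha>\<close>.\<close>

lemma shifted_binomial_sums:
  assumes "\<bar>u\<bar> < 1"
  shows "(\<lambda>m. shifted_binomial \<alpha> m * u ^ m) sums (1 - u) powr (\<alpha> - 1)"
proof -
  have "((\<alpha> - 1) gchoose m) * (- u) ^ m = shifted_binomial \<alpha> m * u ^ m" for m
    unfolding gbinomial_negated_upper[of "\<alpha> - 1" m] power_minus[of u m]
    by (simp add: shifted_binomial_eq_gbinomial)
  with gen_binomial_real[of "- u" "\<alpha> - 1"] assms show ?thesis
    by simp
qed

section \<open>The partition function as a power series in \<open>exp_sum \<theta>\<close>\<close>

lemma exp_sum_pos: "0 < exp_sum \<theta>"
  unfolding exp_sum_def by (intro sum_pos) auto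

text \<open>This form isolates a function of \<open>s\<^sup>2\<close>; the remaining factor
  \<open>1 + s\<close> then repeats each of its coefficients at \<open>2 * m\<close> and
  \<open>2 * m + 1\<close>, whence the index \<open>N div 2\<close>.\<close>

lemma M_eq:
  assumes "\<theta> \<in> Omega"
  shows "M \<alpha> \<theta> = (1 + exp_sum \<theta>) * (1 - (exp_sum \<theta>)\<^sup>2) powr (\<alpha> - 1)"
proof -
  define s where "s = exp_sum \<theta>"
  have s: "0 < s" "s < 1"
    using exp_sum_pos assms by (auto simp: s_def Omega_def)
  have "1 - s\<^sup>2 = (1 + s) * (1 - s)"
    by (simp add: power2_eq_square algebra_simps)
  then have "(1 + s) * (1 - s\<^sup>2) powr (\<alpha> - 1)
      = ((1 + s) powr 1 * (1 + s) powr (\<alpha> - 1)) * (1 - s) powr (\<alpha> - 1)"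
    using s by (simp add: powr_mult)
  also have "\<dots> = (1 + s) powr \<alpha> * (1 - s) powr (\<alpha> - 1)"
    by (subst powr_add [symmetric]) simp
  also have "\<dots> = M \<alpha> \<theta>"
    using s by (simp add: M_def Psi_def powr_def algebra_simps flip: s_def exp_add)
  finally show ?thesis
    by (simp add: s_def)
qed

lemma M_series:
  assumes "\<theta> \<in> Omega"
  shows "(\<lambda>N. shifted_binomial \<alpha> (N div 2) * exp_sum \<theta> ^ N) sums M \<alpha> \<theta>"
proof -
  define s where "s = exp_sum \<theta>"
  have s: "0 < s" "s < 1"
    using exp_sum_pos assms by (auto simp: s_def Omega_def)
  then have "\<bar>s\<^sup>2\<bar> < 1"
    by (simp add: power_less_one_iff)
  from shifted_binomial_sums[OF this]
  have even: "(\<lambda>m. shifted_binomial \<alpha> m * (s\<^sup>2) ^ m) sums (1 - s\<^sup>2) powr (\<alpha> - 1)" .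
  \<comment> \<open>Interleave the series in \<open>s\<^sup>2\<close> (even powers) with
    \<open>s\<close> times the same series (odd powers).\<close>
  have "(\<lambda>N. if even N then shifted_binomial \<alpha> (N div 2) * (s\<^sup>2) ^ (N div 2)
      else s * (shifted_binomial \<alpha> ((N - 1) div 2) * (s\<^sup>2) ^ ((N - 1) div 2)))
    sums (s * (1 - s\<^sup>2) powr (\<alpha> - 1) + (1 - s\<^sup>2) powr (\<alpha> - 1))"
    by (rule sums_if[OF sums_mult[OF even] even])
  also have "(\<lambda>N. if even N then shifted_binomial \<alpha> (N div 2) * (s\<^sup>2) ^ (N div 2)
      else s * (shifted_binomial \<alpha> ((N - 1) div 2) * (s\<^sup>2) ^ ((N - 1) div 2)))
    = (\<lambda>N. shifted_binomial \<alpha> (N div 2) * s ^ N)"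
    by (auto simp: fun_eq_iff elim!: evenE oddE simp flip: power_mult)
  finally show ?thesis
    using M_eq[OF assms] by (simp add: s_def algebra_simps)
qed

section \<open>Levels of constant coordinate sum and the multinomial theorem\<close>

lemma coord_le_coord_sum: "x $ i \<le> coord_sum x"
  unfolding coord_sum_def by (rule member_le_sum) auto

lemma finite_coord_sum_level: "finite {x :: nat ^ 'n. coord_sum x = N}"
proof (rule finite_subset)
  show "{x :: nat ^ 'n. coord_sum x = N} \<subseteq> vec_lambda ` (UNIV \<rightarrow>\<^sub>E {..N})"
  proof
    fix x :: "nat ^ 'n" assume "x \<in> {x. coord_sum x = N}"
    then have "vec_nth x \<in> UNIV \<rightarrow>\<^sub>E {..N}"
      using coord_le_coord_sum[of x] by auto
    then show "x \<in> vec_lambda ` (UNIV \<rightarrow>\<^sub>E {..N})"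
      by (metis image_eqI vec_nth_inverse)
  qed
qed (intro finite_imageI finite_PiE; simp)

lemma coord_sum_add_axis: "coord_sum (y + axis i 1) = Suc (coord_sum y)"
  by (simp add: coord_sum_def sum.distrib axis_def)

lemma coord_sum_eq_0_iff: "coord_sum x = 0 \<longleftrightarrow> x = 0"
  by (simp add: coord_sum_def vec_eq_iff)

lemma add_axis_diff_axis:
  fixes x :: "nat ^ 'n"
  assumes "x $ i > 0"
  shows "x - axis i 1 + axis i 1 = x"
  using assms by (auto simp: vec_eq_iff axis_def)

lemma multinomial_pos: "0 < multinomial x"
  unfolding multinomial_def by (intro divide_pos_pos prod_pos) auto

text \<open>Raising one coordinate changes one factorial in the denominator and the factorial on
  top; the relation is cross-multiplied to avoid quotients.\<close>

lemma multinomial_add_axis: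
  "real (Suc (y $ i)) * multinomial (y + axis i 1) = real (Suc (coord_sum y)) * multinomial y"
proof -
  have "(\<Prod>j\<in>UNIV. fact ((y + axis i 1) $ j) :: real)
      = (\<Prod>j\<in>UNIV. (if j = i then real (Suc (y $ i)) else 1) * fact (y $ j))"
    by (intro prod.cong) (auto simp: axis_def)
  also have "\<dots> = real (Suc (y $ i)) * (\<Prod>j\<in>UNIV. fact (y $ j))"
    by (simp add: prod.distrib)
  finally show ?thesis
    by (simp add: multinomial_def coord_sum_add_axis del: of_nat_Suc One_nat_def)
qed

lemma exp_inner_add_axis:
  "exp (\<theta> \<bullet> real_vec (y + axis i 1)) = exp (\<theta> $ i) * exp (\<theta> \<bullet> real_vec y)"
proof -
  have "real_vec (y + axis i 1) = real_vec y + axis i 1"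
    by (auto simp: real_vec_def vec_eq_iff axis_def)
  then show ?thesis
    by (simp add: inner_add_right inner_axis exp_add)
qed

text \<open>Weighting \<open>x\<close> by \<open>\<Sum>\<^sub>i x\<^sub>i = N + 1\<close> and shifting along each \<open>e\<^sub>i\<close> reduces the sum over
  level \<open>N + 1\<close> to \<open>s\<close> times the sum over level \<open>N\<close>.\<close>

lemma multinomial_theorem:
  fixes \<theta> :: "real ^ 'n"
  shows "(\<Sum>x | coord_sum x = N. multinomial x * exp (\<theta> \<bullet> real_vec x)) = exp_sum \<theta> ^ N"
proof (induction N)
  case 0
  have "{x :: nat ^ 'n. coord_sum x = 0} = {0}"
    by (auto simp: coord_sum_eq_0_iff)
  moreover have "real_vec (0 :: nat ^ 'n) = 0"
    by (simp add: real_vec_def vec_eq_iff)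
  moreover have "multinomial (0 :: nat ^ 'n) = 1"
    by (simp add: multinomial_def coord_sum_def)
  ultimately show ?case
    by simp
next
  case (Suc N)
  define w where "w x = multinomial x * exp (\<theta> \<bullet> real_vec x)" for x
  define L :: "nat \<Rightarrow> (nat ^ 'n) set" where "L k = {x. coord_sum x = k}" for k
  have fin: "finite (L k)" for k
    unfolding L_def by (rule finite_coord_sum_level)
  have shift: "real (Suc (y $ i)) * w (y + axis i 1) = real (Suc N) * (exp (\<theta> $ i) * w y)"
    if "y \<in> L N" for y i
  proof -
    have "real (Suc (y $ i)) * w (y + axis i 1)
        = real (Suc (y $ i)) * multinomial (y + axis i 1) * (exp (\<theta> $ i) * exp (\<theta> \<bullet> real_vec y))"
      by (simp only: w_def exp_inner_add_axis mult.assoc)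
    also have "\<dots> = real (Suc N) * (exp (\<theta> $ i) * w y)"
      using that by (simp add: multinomial_add_axis w_def L_def del: of_nat_Suc One_nat_def)
    finally show ?thesis .
  qed
  have step: "(\<Sum>x\<in>L (Suc N). real (x $ i) * w x) = real (Suc N) * exp (\<theta> $ i) * (\<Sum>y\<in>L N. w y)"
    for i
  proof -
    \<comment> \<open>Points with \<open>x $ i = 0\<close> have weight zero. Dropping them makes the
      truncated subtraction of \<open>axis i 1\<close> a true inverse of the shift.\<close>
    have "(\<Sum>x\<in>L (Suc N). real (x $ i) * w x) = (\<Sum>x\<in>{x\<in>L (Suc N). x $ i > 0}. real (x $ i) * w x)"
      using fin by (intro sum.mono_neutral_right) auto
    also have "\<dots> = (\<Sum>y\<in>L N. real (Suc (y $ i)) * w (y + axis i 1))"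
    proof (rule sum.reindex_bij_witness[of _ "\<lambda>y. y + axis i 1" "\<lambda>x. x - axis i 1"])
      fix x assume x: "x \<in> {x \<in> L (Suc N). x $ i > 0}"
      show "x - axis i 1 + axis i 1 = x"
        using x by (intro add_axis_diff_axis) simp
      then show "x - axis i 1 \<in> L N"
        using x coord_sum_add_axis[of "x - axis i 1" i] by (simp add: L_def)
      show "real (Suc ((x - axis i 1) $ i)) * w (x - axis i 1 + axis i 1) = real (x $ i) * w x"
        using x by (subst add_axis_diff_axis) (auto simp: axis_def)
    next
      fix y assume "y \<in> L N"
      then show "y + axis i 1 \<in> {x \<in> L (Suc N). x $ i > 0}"
        by (simp add: L_def coord_sum_add_axis del: One_nat_def)
    qed (simp add: vec_eq_iff)
    also have "\<dots> = real (Suc N) * exp (\<theta> $ i) * (\<Sum>y\<in>L N. w y)"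
      unfolding sum_distrib_left by (intro sum.cong refl) (simp only: shift mult.assoc)
    finally show ?thesis .
  qed
  have "real (Suc N) * (\<Sum>x\<in>L (Suc N). w x) = (\<Sum>x\<in>L (Suc N). \<Sum>i\<in>UNIV. real (x $ i) * w x)"
    unfolding sum_distrib_left sum_distrib_right [symmetric]
    by (intro sum.cong refl) (auto simp: L_def coord_sum_def simp flip: of_nat_sum)
  also have "\<dots> = (\<Sum>i\<in>UNIV. real (Suc N) * exp (\<theta> $ i) * (\<Sum>y\<in>L N. w y))"
    by (subst sum.swap) (simp only: step)
  also have "\<dots> = real (Suc N) * (exp_sum \<theta> * (\<Sum>y\<in>L N. w y))"
    unfolding exp_sum_def by (simp only: sum_distrib_left [symmetric] sum_distrib_right [symmetric] mult.assoc)
  finally have "(\<Sum>x\<in>L (Suc N). w x) = exp_sum \<theta> * (\<Sum>y\<in>L N. w y)"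
    by (simp del: of_nat_Suc)
  then show ?case
    using Suc.IH by (simp add: w_def L_def)
qed

section \<open>Summation over the lattice and the natural parameter space\<close>

lemma has_sum_coord_sum_level:
  "((\<lambda>x. base_measure \<alpha> x * exp (\<theta> \<bullet> real_vec x)) has_sum
     shifted_binomial \<alpha> (N div 2) * exp_sum \<theta> ^ N) {x. coord_sum x = N}"
proof -
  have "(\<Sum>x | coord_sum x = N. base_measure \<alpha> x * exp (\<theta> \<bullet> real_vec x))
      = shifted_binomial \<alpha> (N div 2) * exp_sum \<theta> ^ N"
    unfolding multinomial_theorem [symmetric] sum_distrib_left
    by (intro sum.cong) (auto simp: base_measure_def)
  with finite_coord_sum_level show ?thesis
    by (metis has_sum_finite)
qed

lemma bij_betw_coord_sum_levels:
  "bij_betw snd (Sigma UNIV (\<lambda>N. {x :: nat ^ 'n. coord_sum x = N})) UNIV"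
  by (rule bij_betw_byWitness[where f' = "\<lambda>x. (coord_sum x, x)"]) auto

lemma base_measure_nonneg: "\<alpha> \<le> 1 \<Longrightarrow> 0 \<le> base_measure \<alpha> x"
  by (simp add: base_measure_def shifted_binomial_nonneg multinomial_pos less_imp_le)

lemma base_measure_has_sum:
  fixes \<theta> :: "real ^ 'n"
  assumes "\<alpha> \<le> 1" "\<theta> \<in> Omega"
  shows "((\<lambda>x. base_measure \<alpha> x * exp (\<theta> \<bullet> real_vec x)) has_sum M \<alpha> \<theta>) UNIV"
proof -
  let ?f = "\<lambda>x. base_measure \<alpha> x * exp (\<theta> \<bullet> real_vec x)"
  let ?a = "\<lambda>N. shifted_binomial \<alpha> (N div 2) * exp_sum \<theta> ^ N"
  let ?S = "Sigma UNIV (\<lambda>N. {x :: nat ^ 'n. coord_sum x = N})"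
  have a: "(?a has_sum M \<alpha> \<theta>) UNIV"
    using assms
    by (intro sums_nonneg_imp_has_sum M_series)
      (simp_all add: shifted_binomial_nonneg exp_sum_pos less_imp_le)
  have "((\<lambda>p. ?f (snd p)) has_sum M \<alpha> \<theta>) ?S"
  proof (rule has_sum_SigmaI[OF _ a])
    \<comment> \<open>Non-negative terms make convergence of the level sums enough for unconditional
      summability over all lattice points.\<close>
    show "(\<lambda>p. ?f (snd p)) summable_on ?S"
      using a assms by (intro summable_on_SigmaI[where g = ?a])
        (auto simp: base_measure_nonneg has_sum_coord_sum_level intro: has_sum_imp_summable)
  qed (simp add: has_sum_coord_sum_level)
  then show ?thesis
    by (rule iffD1[OF has_sum_reindex_bij_betw[OF bij_betw_coord_sum_levels, where f = ?f]])
qed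

lemma natural_parameter_space_base_measure:
  assumes "0 \<le> \<alpha>" "\<alpha> < 1"
  shows "natural_parameter_space (base_measure \<alpha>) = (Omega :: (real ^ 'n) set)"
proof (intro antisym subsetI)
  fix \<theta> :: "real ^ 'n"
  assume "\<theta> \<in> Omega"
  then show "\<theta> \<in> natural_parameter_space (base_measure \<alpha>)"
    using base_measure_has_sum[of \<alpha> \<theta>] assms
    by (auto simp: natural_parameter_space_def intro: has_sum_imp_summable)
next
  fix \<theta> :: "real ^ 'n"
  assume \<theta>: "\<theta> \<in> natural_parameter_space (base_measure \<alpha>)"
  let ?f = "\<lambda>x. base_measure \<alpha> x * exp (\<theta> \<bullet> real_vec x)"
  let ?a = "\<lambda>N. shifted_binomial \<alpha> (N div 2) * exp_sum \<theta> ^ N"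
  obtain S where "(?f has_sum S) UNIV"
    using \<theta> by (auto simp: natural_parameter_space_def summable_on_def)
  then have "((\<lambda>p. ?f (snd p)) has_sum S) (Sigma UNIV (\<lambda>N. {x :: nat ^ 'n. coord_sum x = N}))"
    by (rule iffD2[OF has_sum_reindex_bij_betw[OF bij_betw_coord_sum_levels, where f = ?f]])
  \<comment> \<open>Grouping an unconditionally convergent sum by levels is always legitimate, so
    the series in \<open>exp_sum \<theta>\<close> converges too.\<close>
  then have "(?a has_sum S) UNIV"
    by (rule has_sum_Sigma') (simp add: has_sum_coord_sum_level)
  then have summable: "summable ?a"
    by (auto intro: has_sum_imp_sums sums_summable)
  show "\<theta> \<in> Omega"
  proof (rule ccontr)
    assume "\<theta> \<notin> Omega"
    then have s: "1 \<le> exp_sum \<theta>"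
      by (simp add: Omega_def)
    have "(1 - \<alpha>) * (1 / real N) \<le> ?a N" for N
    proof -
      \<comment> \<open>The lower bound at index \<open>N div 2\<close> is weakened to index
        \<open>N\<close>. For \<open>N \<le> 1\<close> it would give only 0, but there the
        coefficient is 1 and \<open>0 \<le> \<alpha>\<close> suffices.\<close>
      have "(1 - \<alpha>) / real N \<le> shifted_binomial \<alpha> (N div 2)"
      proof (cases "N div 2 = 0")
        case True
        then have "N = 0 \<or> N = 1"
          by auto
        then show ?thesis
          using assms by auto
      next
        case False
        then have "(1 - \<alpha>) / real N \<le> (1 - \<alpha>) / real (N div 2)"
          using assms by (intro divide_left_mono) auto
        also have "\<dots> \<le> shifted_binomial \<alpha> (N div 2)"
          using assms by (intro shifted_binomial_lower_bound) simp
        finally show ?thesis .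
      qed
      also have "\<dots> \<le> ?a N"
        using mult_left_mono[OF one_le_power[OF s, of N] shifted_binomial_nonneg[of \<alpha> "N div 2"]] assms
        by simp
      finally show ?thesis
        by simp
    qed
    then have "summable (\<lambda>N. (1 - \<alpha>) * (1 / real N))"
      using assms by (intro summable_comparison_test'[OF summable, of 0]) auto
    then show False
      using assms not_summable_harmonic[where 'a = real]
      by (simp add: summable_cmult_iff inverse_eq_divide del: times_divide_eq_right mult_1_right)
  qed
qed

section \<open>Openness of \<open>Omega\<close> and full dimension\<close>

lemma open_Omega: "open (Omega :: (real ^ 'n) set)"
proof -
  have "continuous_on UNIV (exp_sum :: real ^ 'n \<Rightarrow> real)"
    unfolding exp_sum_def by (intro continuous_intros)
  then show ?thesis
    unfolding Omega_def by (intro open_Collect_less continuous_intros) auto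
qed

lemma Omega_nonempty: "(Omega :: (real ^ 'n) set) \<noteq> {}"
proof -
  \<comment> \<open>Each of the n coordinates contributes \<open>1 / (2 * n)\<close>, for a total of
    one half.\<close>
  have "(\<chi> i. - ln (2 * real CARD('n))) \<in> (Omega :: (real ^ 'n) set)"
    by (simp add: Omega_def exp_sum_def exp_minus)
  then show ?thesis
    by blast
qed

text \<open>A support containing 0 has affine hull equal to its linear span, and the unit vectors
  already span the space. The hypothesis is the exact support at \<open>\<alpha> = 1\<close>, so one
  lemma serves both cases.\<close>

lemma full_dimensional_Omega:
  fixes h :: "nat ^ 'n \<Rightarrow> real"
  assumes "insert 0 (range (\<lambda>i. axis i 1)) \<subseteq> support h"
  shows "full_dimensional Omega h"
proof -
  have real_vec_0: "real_vec (0 :: nat ^ 'n) = 0"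
    by (simp add: real_vec_def vec_eq_iff)
  have real_vec_axis: "axis i 1 = real_vec (axis i 1 :: nat ^ 'n)" for i
    by (simp add: real_vec_def vec_eq_iff axis_def)
  have "axis i 1 \<in> real_vec ` support h" for i
    unfolding real_vec_axis using assms by (intro imageI) blast
  then have "Basis \<subseteq> real_vec ` support h"
    by (auto simp: Basis_vec_def)
  then have "span (real_vec ` support h) = UNIV"
    using span_mono span_Basis by (metis top.extremum_uniqueI)
  moreover have "0 \<in> real_vec ` support h"
    using assms real_vec_0 by force
  ultimately have "affine hull (real_vec ` support h) = UNIV"
    by (simp add: affine_hull_span_0 hull_inc)
  then show ?thesis
    by (simp add: full_dimensional_def interior_open open_Omega Omega_nonempty)
qed

section \<open>Supports, normalisation and the final assembly\<close>

lemma support_base_measure: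
  "support (base_measure \<alpha>) = {x. 0 < shifted_binomial \<alpha> (coord_sum x div 2)}"
  using multinomial_pos by (auto simp: support_def base_measure_def zero_less_mult_iff dest: less_asym)

lemma support_base_measure_1:
  "support (base_measure 1 :: nat ^ 'n \<Rightarrow> real) = {x. coord_sum x \<in> {0, 1}}"
proof -
  have "0 < shifted_binomial 1 (N div 2) \<longleftrightarrow> N \<in> {0, 1}" for N
    using shifted_binomial_1[of "N div 2"] by (cases "N div 2 = 0") auto
  then show ?thesis
    by (simp add: support_base_measure)
qed

lemma coord_sum_le_1:
  "{x :: nat ^ 'n. coord_sum x \<in> {0, 1}} = insert 0 (range (\<lambda>i. axis i 1))"
proof (intro antisym subsetI)
  fix x :: "nat ^ 'n"
  assume x: "x \<in> {x. coord_sum x \<in> {0, 1}}"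
  show "x \<in> insert 0 (range (\<lambda>i. axis i 1))"
  proof (cases "x = 0")
    case False
    then obtain i where i: "x $ i > 0"
      by (auto simp: vec_eq_iff)
    have "coord_sum x = 1"
      using x False by (auto simp: coord_sum_eq_0_iff)
    \<comment> \<open>Removing a unit vector at a positive coordinate leaves coordinate sum 0, hence
      the zero vector.\<close>
    then have "coord_sum (x - axis i 1) = 0"
      using coord_sum_add_axis[of "x - axis i 1" i] by (simp only: add_axis_diff_axis[OF i])
    then have "x = axis i 1"
      using add_axis_diff_axis[OF i] by (simp add: coord_sum_eq_0_iff)
    then show ?thesis
      by blast
  qed simp
next
  fix x :: "nat ^ 'n"
  assume "x \<in> insert 0 (range (\<lambda>i. axis i 1))"
  then show "x \<in> {x. coord_sum x \<in> {0, 1}}"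
    using coord_sum_add_axis[of 0] by (auto simp: coord_sum_def)
qed

text \<open>Total mass 1 comes from dividing the lattice sum by its value
  \<open>M \<alpha> \<theta>\<close>, the exponential of
  \<open>Psi \<alpha> \<theta>\<close>.\<close>

lemma exponential_family_base_measure:
  assumes "\<alpha> \<le> 1"
  shows "exponential_family (Omega :: (real ^ 'n) set) (base_measure \<alpha>) (Psi \<alpha>)"
proof -
  have "(family_density (base_measure \<alpha>) (Psi \<alpha>) \<theta> has_sum 1) UNIV"
    if "\<theta> \<in> Omega" for \<theta> :: "real ^ 'n"
    using has_sum_divide_const[OF base_measure_has_sum[OF assms that], of "M \<alpha> \<theta>"]
    by (simp add: family_density_def [abs_def] M_def exp_diff)
  then show ?thesis
    using base_measure_has_sum[OF assms, where 'n = 'n]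
    by (simp add: exponential_family_def is_partition_function_def family_density_def
        base_measure_nonneg assms flip: M_def)
qed

theorem proposition6p2:
  shows "(\<forall>\<alpha>\<in>{0..1}. \<forall>m. 0 \<le> shifted_binomial \<alpha> m) \<and>
    (\<forall>\<alpha>\<in>{0..1}. \<forall>x :: nat ^ 'n. 0 \<le> base_measure \<alpha> x) \<and>
    (\<forall>\<alpha>\<in>{0..1}.
       is_partition_function (Omega :: (real ^ 'n) set) (base_measure \<alpha>) (M \<alpha>) \<and>
       exponential_family (Omega :: (real ^ 'n) set) (base_measure \<alpha>) (Psi \<alpha>)) \<and>
    (\<forall>\<alpha>\<in>{0..<1}. regular_family (Omega :: (real ^ 'n) set) (base_measure \<alpha>)) \<and>
    (\<not> regular_family (Omega :: (real ^ 'n) set) (base_measure 1) \<and>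
     finite (support (base_measure 1 :: nat ^ 'n \<Rightarrow> real)) \<and>
     support (base_measure 1 :: nat ^ 'n \<Rightarrow> real) = insert 0 (range (\<lambda>i. axis i 1)) \<and>
     support (base_measure 1 :: nat ^ 'n \<Rightarrow> real) = {x. coord_sum x \<in> {0, 1}} \<and>
     full_dimensional (Omega :: (real ^ 'n) set) (base_measure 1))"
proof (intro conjI ballI allI)
  fix \<alpha> :: real
  assume "\<alpha> \<in> {0..<1}"
  then have \<alpha>: "0 \<le> \<alpha>" "\<alpha> < 1"
    by auto
  then have supp: "support (base_measure \<alpha> :: nat ^ 'n \<Rightarrow> real) = UNIV"
    by (simp add: support_base_measure shifted_binomial_pos)
  show "regular_family (Omega :: (real ^ 'n) set) (base_measure \<alpha>)"
    using \<alpha> by (simp add: regular_family_def natural_parameter_space_base_measure open_Omega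
        full_dimensional_Omega supp infinite_UNIV_vec infinite_UNIV_nat)
next
  show supp: "support (base_measure 1 :: nat ^ 'n \<Rightarrow> real) = insert 0 (range (\<lambda>i. axis i 1))"
    unfolding support_base_measure_1 by (rule coord_sum_le_1)
  then show "finite (support (base_measure 1 :: nat ^ 'n \<Rightarrow> real))"
    by simp
  \<comment> \<open>At \<open>\<alpha> = 1\<close> regularity fails through its demand for infinite
    support; full dimension survives.\<close>
  then show "\<not> regular_family (Omega :: (real ^ 'n) set) (base_measure 1)"
    by (simp add: regular_family_def)
  show "full_dimensional (Omega :: (real ^ 'n) set) (base_measure 1)"
    by (rule full_dimensional_Omega) (simp add: supp)
qed (simp_all add: shifted_binomial_nonneg base_measure_nonneg exponential_family_base_measure
    base_measure_has_sum is_partition_function_def support_base_measure_1)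

end
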